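(* Let $(\mathfrak g,J,\varphi)$ be a nilpotent pseudo-Hermitian quadratic Lie algebra and suppose that $n=\dim(\mathfrak g)>4$. The following hold: (1) Either $\mathfrak g$ is a pHQ-double extension of an $(n-4)$-dimensional pseudo-Hermitian quadratic Lie algebra, or it is the orthogonal direct sum of an $(n-2)$-dimensional nilpotent pseudo-Hermitian quadratic Lie algebra and $\mathbb R^2$ (abelian) endowed with a definite (positive or negative) pseudo-Hermitian metric. (2) If $\mathfrak g$ is not abelian, then it is a pHQ-double extension of an $(n-4)$-dimensional pseudo-Hermitian quadratic Lie algebra. As a consequence, every non-abelian nilpotent pseudo-Hermitian quadratic Lie algebra is obtained by a finite series of pHQ-double extensions starting from an abelian pseudo-Hermitian quadratic Lie algebra.
   Context: All Lie algebras are real. A complex structure on a Lie algebra $\mathfrak g$ is a linear map $J:\mathfrak g\to\mathfrak g$ with $J^2=-I$ and $[x,y]+J[Jx,y]+J[x,Jy]-[Jx,Jy]=0$ for all $x,y\in\mathfrak g$. A quadratic structure on $\mathfrak g$ is a non-degenerate symmetric bilinear form $\varphi:\mathfrak g\times\mathfrak g\to\mathbb R$ with $\varphi([x,y],z)+\varphi(y,[x,z])=0$ for all $x,y,z$. A pseudo-Hermitian quadratic Lie algebra is a triple $(\mathfrak g,J,\varphi)$ where $J$ is a complex structure, $\varphi$ is a quadratic structure, and $\varphi(Jx,Jy)=\varphi(x,y)$ for all $x,y$. Two such triples $(\mathfrak g_1,J_1,\varphi_1)$, $(\mathfrak g_2,J_2,\varphi_2)$ are equivalent if there is a Lie algebra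 isomorphism $\psi:\mathfrak g_1\to\mathfrak g_2$ with $J_2\circ\psi=\psi\circ J_1$ and $\varphi_2(\psi x,\psi y)=\varphi_1(x,y)$; equivalent triples are identified. In orthogonal direct sums, the bracket, complex structure and metric are the direct sums of those of the summands. pHQ-double extension: let $(\mathfrak g_0,[\cdot,\cdot]_0,J_0,\varphi_0)$ be a pseudo-Hermitian quadratic Lie algebra, $D,F$ two $\varphi_0$-skewsymmetric derivations of $\mathfrak g_0$ and $s_0\in\mathfrak g_0$ such that $[F+J_0D,J_0]=0$ and $[F,D]=\mathrm{ad}_{\mathfrak g_0}(s_0)$ (commutators of endomorphisms). The pHQ-double extension of $(\mathfrak g_0,J_0,\varphi_0)$ by a plane by means of $(D,F)$ and $s_0$ is the pseudo-Hermitian quadratic Lie algebra $\mathfrak g=\mathbb Rz\oplus\mathbb Rz'\oplus\mathfrak g_0\oplus\mathbb Rv'\oplus\mathbb Rv$ whose skewsymmetric bracket and symmetric form $\varphi$ are given by the nonzero values ($x,y\in\mathfrak g_0$) $$[v,v']=s_0,\quad [v,x]=Fx-\varphi_0(s_0,x)z',\quad [v',x]=Dx+\varphi_0(s_0,x)z,$$ $$[x,y]=[x,y]_0+\varphi_0(Dx,y)z'+\varphi_0(Fx,y)z,\qquad \varphi(z,v)=\varphi(z',v')=1,\quad \varphi(x,y)=\varphi_0(x,y),$$ with $Jz=z'$, $Jz'=-z$, $Jv=v'$, $Jv'=-v$, $Jx=J_0x$. A pseudo-Hermitian quadratic Lie algebra is called a pHQ-double extension of $\mathfrak g_0$ if it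 is (up to equivalence) of this form for some such $D,F,s_0$. *)

theory Defs
  imports "HOL-Analysis.Analysis"
begin

(* The structure lives on a subspace `carr` of an ambient real vector space; nothing is required of the
   operations outside `carr`.  Since a d-dimensional space embeds in any ambient space of dimension
   at least d, structures of several dimensions can be compared within one ambient type. *)

record 'a phq =
  carr :: "'a set"
  br :: "'a \<Rightarrow> 'a \<Rightarrow> 'a"
  cpx :: "'a \<Rightarrow> 'a"
  met :: "'a \<Rightarrow> 'a \<Rightarrow> real"

definition linear_between :: "'a::real_vector set \<Rightarrow> 'b::real_vector set \<Rightarrow> ('a \<Rightarrow> 'b) \<Rightarrow> bool" where
  "linear_between V W f \<longleftrightarrow>
     (\<forall>x\<in>V. f x \<in> W) \<and>
     (\<forall>x\<in>V. \<forall>y\<in>V. f (x + y) = f x + f y) \<and>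
     (\<forall>c. \<forall>x\<in>V. f (c *\<^sub>R x) = c *\<^sub>R f x)"

definition bilinear_between ::
  "'a::real_vector set \<Rightarrow> 'b::real_vector set \<Rightarrow> ('a \<Rightarrow> 'a \<Rightarrow> 'b) \<Rightarrow> bool" where
  "bilinear_between V W f \<longleftrightarrow>
     (\<forall>x\<in>V. linear_between V W (\<lambda>y. f x y)) \<and>
     (\<forall>y\<in>V. linear_between V W (\<lambda>x. f x y))"

definition lie_algebra :: "'a::real_vector phq \<Rightarrow> bool" where
  "lie_algebra g \<longleftrightarrow>
     subspace (carr g) \<and> (\<exists>B. finite B \<and> span B = carr g) \<and>
     bilinear_between (carr g) (carr g) (br g) \<and>
     (\<forall>x\<in>carr g. br g x x = 0) \<and>
     (\<forall>x\<in>carr g. \<forall>y\<in>carr g. \<forall>z\<in>carr g.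
        br g x (br g y z) + br g y (br g z x) + br g z (br g x y) = 0)"

definition complex_structure :: "'a::real_vector phq \<Rightarrow> bool" where
  "complex_structure g \<longleftrightarrow>
     linear_between (carr g) (carr g) (cpx g) \<and>
     (\<forall>x\<in>carr g. cpx g (cpx g x) = - x) \<and>
     (\<forall>x\<in>carr g. \<forall>y\<in>carr g.
        br g x y + cpx g (br g (cpx g x) y) + cpx g (br g x (cpx g y))
          - br g (cpx g x) (cpx g y) = 0)"

definition quadratic_structure :: "'a::real_vector phq \<Rightarrow> bool" where
  "quadratic_structure g \<longleftrightarrow>
     bilinear_between (carr g) UNIV (met g) \<and>
     (\<forall>x\<in>carr g. \<forall>y\<in>carr g. met g x y = met g y x) \<and>
     (\<forall>x\<in>carr g. (\<forall>y\<in>carr g. met g x y = 0) \<longrightarrow> x = 0) \<and>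
     (\<forall>x\<in>carr g. \<forall>y\<in>carr g. \<forall>z\<in>carr g.
        met g (br g x y) z + met g y (br g x z) = 0)"

definition phq_lie_algebra :: "'a::real_vector phq \<Rightarrow> bool" where
  "phq_lie_algebra g \<longleftrightarrow>
     lie_algebra g \<and> complex_structure g \<and> quadratic_structure g \<and>
     (\<forall>x\<in>carr g. \<forall>y\<in>carr g. met g (cpx g x) (cpx g y) = met g x y)"

definition phq_equivalent :: "'a::real_vector phq \<Rightarrow> 'b::real_vector phq \<Rightarrow> bool" where
  "phq_equivalent g h \<longleftrightarrow>
     (\<exists>\<psi>. linear_between (carr g) (carr h) \<psi> \<and> bij_betw \<psi> (carr g) (carr h) \<and>
        (\<forall>x\<in>carr g. \<forall>y\<in>carr g. \<psi> (br g x y) = br h (\<psi> x) (\<psi> y)) \<and>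
        (\<forall>x\<in>carr g. cpx h (\<psi> x) = \<psi> (cpx g x)) \<and>
        (\<forall>x\<in>carr g. \<forall>y\<in>carr g. met h (\<psi> x) (\<psi> y) = met g x y))"

definition abelian_lie :: "'a::real_vector phq \<Rightarrow> bool" where
  "abelian_lie g \<longleftrightarrow> (\<forall>x\<in>carr g. \<forall>y\<in>carr g. br g x y = 0)"

fun lower_central :: "'a::real_vector phq \<Rightarrow> nat \<Rightarrow> 'a set" where
  "lower_central g 0 = carr g"
| "lower_central g (Suc k) = span {br g x y | x y. x \<in> carr g \<and> y \<in> lower_central g k}"

definition nilpotent_lie :: "'a::real_vector phq \<Rightarrow> bool" where
  "nilpotent_lie g \<longleftrightarrow> (\<exists>k. lower_central g k = {0})"

definition orthogonal_sum ::
  "'a::real_vector phq \<Rightarrow> 'b::real_vector phq \<Rightarrow> ('a \<times> 'b) phq" where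
  "orthogonal_sum g h =
     \<lparr> carr = carr g \<times> carr h,
       br = (\<lambda>(x, x') (y, y'). (br g x y, br h x' y')),
       cpx = (\<lambda>(x, x'). (cpx g x, cpx h x')),
       met = (\<lambda>(x, x') (y, y'). met g x y + met h x' y') \<rparr>"

definition definite_metric :: "'a::real_vector phq \<Rightarrow> bool" where
  "definite_metric g \<longleftrightarrow>
     (\<forall>x\<in>carr g. x \<noteq> 0 \<longrightarrow> met g x x > 0) \<or> (\<forall>x\<in>carr g. x \<noteq> 0 \<longrightarrow> met g x x < 0)"

definition skew_derivation :: "'a::real_vector phq \<Rightarrow> ('a \<Rightarrow> 'a) \<Rightarrow> bool" where
  "skew_derivation g D \<longleftrightarrow>
     linear_between (carr g) (carr g) D \<and>
     (\<forall>x\<in>carr g. \<forall>y\<in>carr g. D (br g x y) = br g (D x) y + br g x (D y)) \<and>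
     (\<forall>x\<in>carr g. \<forall>y\<in>carr g. met g (D x) y = - met g x (D y))"

definition extension_data ::
  "'a::real_vector phq \<Rightarrow> ('a \<Rightarrow> 'a) \<Rightarrow> ('a \<Rightarrow> 'a) \<Rightarrow> 'a \<Rightarrow> bool" where
  "extension_data g D F s \<longleftrightarrow>
     skew_derivation g D \<and> skew_derivation g F \<and> s \<in> carr g \<and>
     (\<forall>x\<in>carr g. F (cpx g x) + cpx g (D (cpx g x)) = cpx g (F x + cpx g (D x))) \<and>
     (\<forall>x\<in>carr g. F (D x) - D (F x) = br g s x)"

(* The tuple (a, a', x, b', b) stands for a z + a' z' + x + b' v' + b v; the operations are the
   (skew-, bi-)linear extensions of the defining values on z, z', g, v', v. *)

definition double_extension ::
  "'a::real_vector phq \<Rightarrow> ('a \<Rightarrow> 'a) \<Rightarrow> ('a \<Rightarrow> 'a) \<Rightarrow> 'a \<Rightarrow>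
    (real \<times> real \<times> 'a \<times> real \<times> real) phq" where
  "double_extension g D F s =
     \<lparr> carr = UNIV \<times> UNIV \<times> carr g \<times> UNIV \<times> UNIV,
       br = (\<lambda>(a, a', x, b', b) (c, c', y, d', d).
         (met g (F x) y + b' * met g s y - d' * met g s x,
          met g (D x) y - b * met g s y + d * met g s x,
          br g x y + (b * d' - b' * d) *\<^sub>R s
            + b *\<^sub>R F y - d *\<^sub>R F x + b' *\<^sub>R D y - d' *\<^sub>R D x,
          0, 0)),
       cpx = (\<lambda>(a, a', x, b', b). (- a', a, cpx g x, b, - b')),
       met = (\<lambda>(a, a', x, b', b) (c, c', y, d', d).
         a * d + b * c + a' * d' + b' * c' + met g x y) \<rparr>"

definition is_double_extension_of :: "'a::real_vector phq \<Rightarrow> 'b::real_vector phq \<Rightarrow> bool" where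
  "is_double_extension_of g h \<longleftrightarrow>
     phq_lie_algebra g \<and> phq_lie_algebra h \<and>
     (\<exists>D F s. extension_data h D F s \<and> phq_equivalent g (double_extension h D F s))"

inductive iterated_double_extension :: "'a::real_vector phq \<Rightarrow> bool" where
  base: "phq_lie_algebra g \<Longrightarrow> abelian_lie g \<Longrightarrow> iterated_double_extension g"
| step: "iterated_double_extension h \<Longrightarrow> is_double_extension_of g h \<Longrightarrow> iterated_double_extension g"

end

theory Submission
  imports Defs
begin

text \<open>
  Write \<open>\<phi>\<close> for the metric. Splitting off a double extension amounts to finding a nonzero isotropic
  vector \<open>z\<close> such that \<open>z\<close> and \<open>J z\<close> are both central. The plane spanned by \<open>z\<close> and \<open>J z\<close> is then
  totally isotropic, because \<open>\<phi>(z, J z) = 0\<close>, and has a dual isotropic plane spanned by some \<open>v\<close> and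
  \<open>J v\<close>. The orthogonal complement \<open>H\<close> of the four vectors is a copy of the subquotient \<open>P\<^sup>\<bottom> / P\<close>,
  where \<open>P\<close> is the plane of \<open>z\<close> and \<open>J z\<close>. With the projected bracket \<open>H\<close> is again a nilpotent
  pseudo-Hermitian quadratic Lie algebra, and the algebra is its double extension by means of
  the projections of \<open>ad (J v)\<close> and \<open>ad v\<close> to \<open>H\<close> and the vector \<open>[v, J v]\<close>
  (locale \<open>central_hyperbolic\<close>).

  The vector \<open>z\<close> exists as soon as \<open>g\<close> is nilpotent and not abelian (\<open>exists_central_isotropic\<close>).
  Let \<open>Z\<close> be the centre and \<open>W = Z \<inter> J Z\<close>. Invariance of \<open>\<phi>\<close> says that the vectors orthogonal to
  \<open>[g, g] + J [g, g]\<close> are exactly those of \<open>W\<close>, so any vector orthogonal to \<open>W + [g, g] + J [g, g]\<close>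
  lies in \<open>W\<close> and is orthogonal to itself. It remains to see that this sum is not all of \<open>g\<close>, and
  this is where integrability and nilpotency meet (\<open>nilpotent_complex_hull_eq\<close>): if
  \<open>g = W + I + J I\<close>, then the bracket of two elements is a sum of brackets with one entry in \<open>I\<close> and
  brackets \<open>[J u, J w]\<close> with \<open>u\<close> and \<open>w\<close> in \<open>I\<close>, and integrability moves the latter into
  \<open>[g, I] + J [g, I]\<close>. So \<open>g = W + I + J I\<close> persists when \<open>I\<close> runs down the lower central series,
  and at its end \<open>g = W\<close> is abelian. For \<open>W = 0\<close> this is the dual form of Salamon's theorem that a
  nilpotent Lie algebra with a complex structure has a closed form of type \<open>(1,0)\<close>.

  If \<open>g\<close> is abelian, every vector is central: an isotropic vector gives a double extension
  as before, and a vector \<open>e\<close> with \<open>\<phi>(e, e) \<noteq> 0\<close> spans together with \<open>J e\<close> a definite plane that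
  splits off orthogonally. Iterating the non-abelian case, which preserves nilpotency
  and lowers the dimension, yields the series of double extensions.
\<close>

section \<open>Finite-dimensional subspaces\<close>

lemma linear_betweenD:
  assumes "linear_between V W f"
  shows "x \<in> V \<Longrightarrow> f x \<in> W"
    and "x \<in> V \<Longrightarrow> y \<in> V \<Longrightarrow> f (x + y) = f x + f y"
    and "x \<in> V \<Longrightarrow> f (c *\<^sub>R x) = c *\<^sub>R f x"
  using assms unfolding linear_between_def by auto

lemma bilinear_betweenD:
  assumes "bilinear_between V W f"
  shows "x \<in> V \<Longrightarrow> y \<in> V \<Longrightarrow> f x y \<in> W"
    and "x \<in> V \<Longrightarrow> y \<in> V \<Longrightarrow> z \<in> V \<Longrightarrow> f (x + y) z = f x z + f y z"
    and "x \<in> V \<Longrightarrow> y \<in> V \<Longrightarrow> z \<in> V \<Longrightarrow> f x (y + z) = f x y + f x z"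
    and "x \<in> V \<Longrightarrow> y \<in> V \<Longrightarrow> f (c *\<^sub>R x) y = c *\<^sub>R f x y"
    and "x \<in> V \<Longrightarrow> y \<in> V \<Longrightarrow> f x (c *\<^sub>R y) = c *\<^sub>R f x y"
  using assms unfolding bilinear_between_def linear_between_def by auto

lemma finite_basis_of_subspace:
  fixes S :: "'a::real_vector set"
  assumes "subspace S" "S \<subseteq> span A" "finite A"
  obtains B where "B \<subseteq> S" "independent B" "finite B" "span B = S" "card B = dim S"
proof -
  obtain B where B: "B \<subseteq> S" "independent B" "S \<subseteq> span B" "card B = dim S"
    by (rule basis_exists)
  have "span B = S"
    using B(1,3) assms(1) by (metis span_eq_iff span_mono subset_antisym)
  moreover have "finite B"
    using independent_span_bound[OF assms(3) B(2)] B(1) assms(2) by auto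
  ultimately show thesis using B that by blast
qed

lemma dim_proper_subspace_less:
  fixes S :: "'a::real_vector set"
  assumes "subspace S" "subspace V" "S \<subset> V" "V \<subseteq> span A" "finite A"
  shows "dim S < dim V"
proof -
  obtain B where B: "B \<subseteq> S" "independent B" "finite B" "span B = S" "card B = dim S"
    using finite_basis_of_subspace[of S A] assms by blast
  obtain C where C: "B \<subseteq> C" "C \<subseteq> V" "independent C" "V \<subseteq> span C"
    using maximal_independent_subset_extend[of B V] B(1,2) assms(3) by blast
  have "finite C"
    using independent_span_bound[OF assms(5) C(3)] C(2) assms(4) by auto
  moreover have "B \<noteq> C" using B(4) C(4) assms(3) by blast
  ultimately have "card B < card C" using C(1) by (simp add: psubset_card_mono psubsetI)
  then show ?thesis using B(5) C(2-4) basis_card_eq_dim by metis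
qed

lemma dim_hyperplane:
  fixes V :: "'a::real_vector set" and f :: "'a \<Rightarrow> real"
  assumes V: "subspace V" "V \<subseteq> span A" "finite A"
    and f: "linear_between V UNIV f" and u: "u \<in> V" "f u \<noteq> 0"
  shows "subspace {x \<in> V. f x = 0}" and "dim V = Suc (dim {x \<in> V. f x = 0})"
proof -
  let ?S = "{x \<in> V. f x = 0}"
  note lin = linear_betweenD[OF f]
  have f0: "f 0 = 0" using lin(3)[OF u(1), of 0] by simp
  show S: "subspace ?S"
    using V(1) lin f0 by (auto simp: subspace_def)
  obtain B where B: "B \<subseteq> ?S" "independent B" "finite B" "span B = ?S" "card B = dim ?S"
    using finite_basis_of_subspace[OF S, of A] V by blast
  have "u \<notin> span B" using B(4) u by simp
  then have ind: "independent (insert u B)" and "u \<notin> B"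
    using B(2) span_base[of u B] by (auto simp: independent_insert)
  have "V \<subseteq> span (insert u B)"
  proof
    fix x assume x: "x \<in> V"
    define y where "y = x + (- (f x / f u)) *\<^sub>R u"
    have cu: "(- (f x / f u)) *\<^sub>R u \<in> V" using V(1) u subspace_scale by blast
    then have "y \<in> V" using V(1) x unfolding y_def by (rule subspace_add[rotated 2])
    moreover have "f y = 0"
      unfolding y_def lin(2)[OF x cu] lin(3)[OF u(1)] using u(2) by simp
    ultimately have "y \<in> span B" using B(4) by simp
    then have "y + (f x / f u) *\<^sub>R u \<in> span (insert u B)"
      by (meson insertI1 span_add span_base span_mono span_scale subsetD subset_insertI)
    then show "x \<in> span (insert u B)" by (simp add: y_def)
  qed
  moreover have "insert u B \<subseteq> V" using B(1) u by auto
  ultimately have "card (insert u B) = dim V" using ind basis_card_eq_dim by blast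
  then show "dim V = Suc (dim ?S)" using B(3,5) \<open>u \<notin> B\<close> by simp
qed

section \<open>Calculus in a pseudo-Hermitian quadratic Lie algebra\<close>

locale phq_algebra =
  fixes g :: "'a::real_vector phq"
  assumes phq: "phq_lie_algebra g"
begin

lemma
  shows subspace_carr: "subspace (carr g)"
    and finite_dim: "\<exists>B. finite B \<and> span B = carr g"
    and bilinear_br: "bilinear_between (carr g) (carr g) (br g)"
    and br_self [simp]: "x \<in> carr g \<Longrightarrow> br g x x = 0"
    and jacobi: "x \<in> carr g \<Longrightarrow> y \<in> carr g \<Longrightarrow> w \<in> carr g \<Longrightarrow>
        br g x (br g y w) + br g y (br g w x) + br g w (br g x y) = 0"
    and linear_cpx: "linear_between (carr g) (carr g) (cpx g)"
    and cpx_cpx [simp]: "x \<in> carr g \<Longrightarrow> cpx g (cpx g x) = - x"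
    and integrable: "x \<in> carr g \<Longrightarrow> y \<in> carr g \<Longrightarrow>
        br g x y + cpx g (br g (cpx g x) y) + cpx g (br g x (cpx g y))
          - br g (cpx g x) (cpx g y) = 0"
    and bilinear_met: "bilinear_between (carr g) UNIV (met g)"
    and met_sym: "x \<in> carr g \<Longrightarrow> y \<in> carr g \<Longrightarrow> met g x y = met g y x"
    and nondegenerate: "x \<in> carr g \<Longrightarrow> (\<And>y. y \<in> carr g \<Longrightarrow> met g x y = 0) \<Longrightarrow> x = 0"
    and invariant: "x \<in> carr g \<Longrightarrow> y \<in> carr g \<Longrightarrow> w \<in> carr g \<Longrightarrow>
        met g (br g x y) w + met g y (br g x w) = 0"
    and met_cpx_cpx [simp]: "x \<in> carr g \<Longrightarrow> y \<in> carr g \<Longrightarrow>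
        met g (cpx g x) (cpx g y) = met g x y"
  using phq
  unfolding phq_lie_algebra_def lie_algebra_def complex_structure_def quadratic_structure_def
  by simp_all

lemma carr_closed [simp]:
  shows "0 \<in> carr g"
    and "x \<in> carr g \<Longrightarrow> y \<in> carr g \<Longrightarrow> x + y \<in> carr g"
    and "x \<in> carr g \<Longrightarrow> y \<in> carr g \<Longrightarrow> x - y \<in> carr g"
    and "x \<in> carr g \<Longrightarrow> - x \<in> carr g"
    and "x \<in> carr g \<Longrightarrow> c *\<^sub>R x \<in> carr g"
    and "x \<in> carr g \<Longrightarrow> y \<in> carr g \<Longrightarrow> br g x y \<in> carr g"
    and "x \<in> carr g \<Longrightarrow> cpx g x \<in> carr g"
  using subspace_carr bilinear_betweenD(1)[OF bilinear_br] linear_betweenD(1)[OF linear_cpx]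
  by (auto simp: subspace_0 subspace_add subspace_diff subspace_neg subspace_scale)

lemma cpx_linear [simp]:
  shows "x \<in> carr g \<Longrightarrow> y \<in> carr g \<Longrightarrow> cpx g (x + y) = cpx g x + cpx g y"
    and "x \<in> carr g \<Longrightarrow> y \<in> carr g \<Longrightarrow> cpx g (x - y) = cpx g x - cpx g y"
    and "x \<in> carr g \<Longrightarrow> cpx g (c *\<^sub>R x) = c *\<^sub>R cpx g x"
    and "x \<in> carr g \<Longrightarrow> cpx g (- x) = - cpx g x"
    and "cpx g 0 = 0"
proof -
  note lin = linear_betweenD(2,3)[OF linear_cpx]
  show neg: "cpx g (- x) = - cpx g x" if "x \<in> carr g" for x
    using lin(2)[OF that, of "- 1"] by simp
  show "x \<in> carr g \<Longrightarrow> y \<in> carr g \<Longrightarrow> cpx g (x - y) = cpx g x - cpx g y"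
    using lin(1)[of x "- y"] neg by simp
  show "cpx g 0 = 0" using lin(2)[of 0 0] by simp
qed (use linear_betweenD(2,3)[OF linear_cpx] in auto)

lemma br_bilinear [simp]:
  shows "x \<in> carr g \<Longrightarrow> y \<in> carr g \<Longrightarrow> w \<in> carr g \<Longrightarrow> br g (x + y) w = br g x w + br g y w"
    and "x \<in> carr g \<Longrightarrow> y \<in> carr g \<Longrightarrow> w \<in> carr g \<Longrightarrow> br g x (y + w) = br g x y + br g x w"
    and "x \<in> carr g \<Longrightarrow> y \<in> carr g \<Longrightarrow> w \<in> carr g \<Longrightarrow> br g (x - y) w = br g x w - br g y w"
    and "x \<in> carr g \<Longrightarrow> y \<in> carr g \<Longrightarrow> w \<in> carr g \<Longrightarrow> br g x (y - w) = br g x y - br g x w"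
    and "x \<in> carr g \<Longrightarrow> y \<in> carr g \<Longrightarrow> br g (c *\<^sub>R x) y = c *\<^sub>R br g x y"
    and "x \<in> carr g \<Longrightarrow> y \<in> carr g \<Longrightarrow> br g x (c *\<^sub>R y) = c *\<^sub>R br g x y"
    and "x \<in> carr g \<Longrightarrow> y \<in> carr g \<Longrightarrow> br g (- x) y = - br g x y"
    and "x \<in> carr g \<Longrightarrow> y \<in> carr g \<Longrightarrow> br g x (- y) = - br g x y"
    and "x \<in> carr g \<Longrightarrow> br g 0 x = 0"
    and "x \<in> carr g \<Longrightarrow> br g x 0 = 0"
proof -
  note bil = bilinear_betweenD(2-5)[OF bilinear_br]
  show neg1: "br g (- x) y = - br g x y" if "x \<in> carr g" "y \<in> carr g" for x y
    using bil(3)[OF that, of "- 1"] by simp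
  show neg2: "br g x (- y) = - br g x y" if "x \<in> carr g" "y \<in> carr g" for x y
    using bil(4)[OF that, of "- 1"] by simp
  show "x \<in> carr g \<Longrightarrow> y \<in> carr g \<Longrightarrow> w \<in> carr g \<Longrightarrow> br g (x - y) w = br g x w - br g y w"
    using bil(1)[of x "- y" w] neg1[of y w] by simp
  show "x \<in> carr g \<Longrightarrow> y \<in> carr g \<Longrightarrow> w \<in> carr g \<Longrightarrow> br g x (y - w) = br g x y - br g x w"
    using bil(2)[of x y "- w"] neg2[of x w] by simp
  show "x \<in> carr g \<Longrightarrow> br g 0 x = 0" using bil(3)[of 0 x 0] by simp
  show "x \<in> carr g \<Longrightarrow> br g x 0 = 0" using bil(4)[of x 0 0] by simp
qed (use bilinear_betweenD(2-5)[OF bilinear_br] in auto)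

lemma met_bilinear [simp]:
  shows "x \<in> carr g \<Longrightarrow> y \<in> carr g \<Longrightarrow> w \<in> carr g \<Longrightarrow> met g (x + y) w = met g x w + met g y w"
    and "x \<in> carr g \<Longrightarrow> y \<in> carr g \<Longrightarrow> w \<in> carr g \<Longrightarrow> met g x (y + w) = met g x y + met g x w"
    and "x \<in> carr g \<Longrightarrow> y \<in> carr g \<Longrightarrow> w \<in> carr g \<Longrightarrow> met g (x - y) w = met g x w - met g y w"
    and "x \<in> carr g \<Longrightarrow> y \<in> carr g \<Longrightarrow> w \<in> carr g \<Longrightarrow> met g x (y - w) = met g x y - met g x w"
    and "x \<in> carr g \<Longrightarrow> y \<in> carr g \<Longrightarrow> met g (c *\<^sub>R x) y = c * met g x y"
    and "x \<in> carr g \<Longrightarrow> y \<in> carr g \<Longrightarrow> met g x (c *\<^sub>R y) = c * met g x y"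
    and "x \<in> carr g \<Longrightarrow> y \<in> carr g \<Longrightarrow> met g (- x) y = - met g x y"
    and "x \<in> carr g \<Longrightarrow> y \<in> carr g \<Longrightarrow> met g x (- y) = - met g x y"
    and "x \<in> carr g \<Longrightarrow> met g 0 x = 0"
    and "x \<in> carr g \<Longrightarrow> met g x 0 = 0"
proof -
  note bil = bilinear_betweenD(2-5)[OF bilinear_met]
  show neg1: "met g (- x) y = - met g x y" if "x \<in> carr g" "y \<in> carr g" for x y
    using bil(3)[OF that, of "- 1"] by simp
  show neg2: "met g x (- y) = - met g x y" if "x \<in> carr g" "y \<in> carr g" for x y
    using bil(4)[OF that, of "- 1"] by simp
  show "x \<in> carr g \<Longrightarrow> y \<in> carr g \<Longrightarrow> w \<in> carr g \<Longrightarrow> met g (x - y) w = met g x w - met g y w"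
    using bil(1)[of x "- y" w] neg1[of y w] by simp
  show "x \<in> carr g \<Longrightarrow> y \<in> carr g \<Longrightarrow> w \<in> carr g \<Longrightarrow> met g x (y - w) = met g x y - met g x w"
    using bil(2)[of x y "- w"] neg2[of x w] by simp
  show "x \<in> carr g \<Longrightarrow> met g 0 x = 0" using bil(3)[of 0 x 0] by simp
  show "x \<in> carr g \<Longrightarrow> met g x 0 = 0" using bil(4)[of x 0 0] by simp
qed (use bilinear_betweenD(2-5)[OF bilinear_met] in auto)

lemma br_skew:
  assumes "x \<in> carr g" "y \<in> carr g"
  shows "br g x y = - br g y x"
proof -
  have "br g (x + y) (x + y) = 0" using assms by (intro br_self) simp
  then have "br g x x + br g y x + (br g x y + br g y y) = 0"
    using assms by (simp del: br_self)
  then show ?thesis using assms by (simp add: eq_neg_iff_add_eq_0 add.commute)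
qed

lemma met_br_right:
  assumes "x \<in> carr g" "y \<in> carr g" "w \<in> carr g"
  shows "met g x (br g y w) = met g (br g x y) w"
  using invariant[of y x w] br_skew[of y x] assms by simp

lemma met_cpx_right:
  assumes "x \<in> carr g" "y \<in> carr g"
  shows "met g x (cpx g y) = - met g (cpx g x) y"
  using met_cpx_cpx[of x "cpx g y"] assms by simp

lemma met_self_cpx [simp]:
  assumes "x \<in> carr g"
  shows "met g x (cpx g x) = 0" and "met g (cpx g x) x = 0"
  using met_cpx_right[OF assms assms] met_sym[of x "cpx g x"] assms by auto

lemma linear_met_left: "w \<in> carr g \<Longrightarrow> linear_between (carr g) UNIV (\<lambda>x. met g x w)"
  by (simp add: linear_between_def)

text \<open>The Jacobi identity in the form that makes \<open>ad x\<close> a derivation.\<close>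
lemma leibniz:
  assumes "x \<in> carr g" "y \<in> carr g" "w \<in> carr g"
  shows "br g x (br g y w) = br g (br g x y) w + br g y (br g x w)"
  using jacobi[OF assms] br_skew[of w x] br_skew[of w "br g x y"] assms
  by (simp add: algebra_simps)

text \<open>Each linear condition lowers the dimension by at most one.\<close>
lemma orthogonal_dim_bound:
  assumes "finite B" "B \<subseteq> carr g"
  shows "subspace {x \<in> carr g. \<forall>b\<in>B. met g x b = 0} \<and>
    dim (carr g) \<le> dim {x \<in> carr g. \<forall>b\<in>B. met g x b = 0} + card B"
  using assms
proof (induction B)
  case empty
  then show ?case by (simp add: subspace_carr)
next
  case (insert b B)
  let ?P = "{x \<in> carr g. \<forall>b\<in>B. met g x b = 0}"
  have P: "subspace ?P" "dim (carr g) \<le> dim ?P + card B" using insert by auto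
  have eq: "{x \<in> carr g. \<forall>c\<in>insert b B. met g x c = 0} = {x \<in> ?P. met g x b = 0}" by auto
  obtain A where A: "finite A" "span A = carr g" using finite_dim by blast
  show ?case
  proof (cases "\<exists>u\<in>?P. met g u b \<noteq> 0")
    case True
    then obtain u where u: "u \<in> ?P" "met g u b \<noteq> 0" by blast
    have "linear_between ?P UNIV (\<lambda>x. met g x b)"
      using linear_met_left[of b] insert.prems by (auto simp: linear_between_def)
    from dim_hyperplane[OF P(1) _ A(1) this u] show ?thesis
      using P(2) A(2) insert.hyps unfolding eq by auto
  next
    case False
    then have "{x \<in> ?P. met g x b = 0} = ?P" by auto
    then show ?thesis using P insert.hyps unfolding eq by simp
  qed
qed

text \<open>The number of conditions is the dimension of the subspace, which is too small to exhaust the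
  space.\<close>
lemma exists_orthogonal:
  assumes "subspace S" "S \<subseteq> carr g" "S \<noteq> carr g"
  obtains x where "x \<in> carr g" "x \<noteq> 0" "\<And>y. y \<in> S \<Longrightarrow> met g x y = 0"
proof -
  obtain A where A: "finite A" "span A = carr g" using finite_dim by blast
  obtain B where B: "B \<subseteq> S" "independent B" "finite B" "span B = S" "card B = dim S"
    using finite_basis_of_subspace[of S A] assms A by blast
  have "dim S < dim (carr g)"
    using dim_proper_subspace_less[of S "carr g" A] assms subspace_carr A by blast
  then have "dim {x \<in> carr g. \<forall>b\<in>B. met g x b = 0} \<noteq> 0"
    using orthogonal_dim_bound[of B] B assms(2) by fastforce
  then have "\<not> {x \<in> carr g. \<forall>b\<in>B. met g x b = 0} \<subseteq> {0}"
    using dim_le_card[of "{x \<in> carr g. \<forall>b\<in>B. met g x b = 0}" "{}"] by auto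
  then obtain x where x: "x \<in> carr g" "x \<noteq> 0" "\<forall>b\<in>B. met g x b = 0" by blast
  have "met g x y = 0" if "y \<in> S" for y
  proof -
    have "subspace {y \<in> carr g. met g x y = 0}"
      using x(1) by (auto simp: subspace_def)
    moreover have "B \<subseteq> {y \<in> carr g. met g x y = 0}" using x(3) B(1) assms(2) by auto
    ultimately have "span B \<subseteq> {y \<in> carr g. met g x y = 0}" by (rule span_minimal[rotated])
    then show ?thesis using that B(4) by auto
  qed
  then show thesis using that x by blast
qed

section \<open>A central isotropic complex line\<close>

lemma lower_central_subspace: "subspace (lower_central g k) \<and> lower_central g k \<subseteq> carr g"
proof (induction k)
  case 0
  then show ?case by (simp add: subspace_carr)
next
  case (Suc k)
  then have "{br g x y | x y. x \<in> carr g \<and> y \<in> lower_central g k} \<subseteq> carr g" by auto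
  then show ?case by (simp add: span_minimal subspace_carr)
qed

lemma br_mem_lower_central:
  "x \<in> carr g \<Longrightarrow> y \<in> lower_central g k \<Longrightarrow> br g x y \<in> lower_central g (Suc k)"
  by (auto intro: span_base)

definition complex_hull :: "'a set \<Rightarrow> 'a set \<Rightarrow> 'a set" where
  "complex_hull W I = {w + u + cpx g u' | w u u'. w \<in> W \<and> u \<in> I \<and> u' \<in> I}"

lemma complex_hull_subspace:
  assumes W: "subspace W" "W \<subseteq> carr g" and I: "subspace I" "I \<subseteq> carr g"
  shows "subspace (complex_hull W I)" and "complex_hull W I \<subseteq> carr g"
    and "W \<subseteq> complex_hull W I" and "I \<subseteq> complex_hull W I"
    and "(\<And>w. w \<in> W \<Longrightarrow> cpx g w \<in> W) \<Longrightarrow>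
        x \<in> complex_hull W I \<Longrightarrow> cpx g x \<in> complex_hull W I"
proof -
  have memI: "w + u + cpx g u' \<in> complex_hull W I" if "w \<in> W" "u \<in> I" "u' \<in> I" for w u u'
    unfolding complex_hull_def using that by blast
  note zero = subspace_0[OF W(1)] subspace_0[OF I(1)]
  show "W \<subseteq> complex_hull W I" using memI[OF _ zero(2) zero(2)] by auto
  show "I \<subseteq> complex_hull W I" using memI[OF zero(1) _ zero(2)] by auto
  show "complex_hull W I \<subseteq> carr g"
    unfolding complex_hull_def using subsetD[OF W(2)] subsetD[OF I(2)] by auto
  show "subspace (complex_hull W I)"
  proof (rule subspaceI)
    show "0 \<in> complex_hull W I" using memI[OF zero(1) zero(2) zero(2)] by simp
  next
    fix x y assume "x \<in> complex_hull W I" "y \<in> complex_hull W I"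
    then obtain w u u' w2 t t' where e: "x = w + u + cpx g u'" "y = w2 + t + cpx g t'"
      and m: "w \<in> W" "u \<in> I" "u' \<in> I" "w2 \<in> W" "t \<in> I" "t' \<in> I"
      unfolding complex_hull_def by blast
    have "x + y = (w + w2) + (u + t) + cpx g (u' + t')"
      using m I by (simp add: e subsetD[OF I(2)])
    then show "x + y \<in> complex_hull W I"
      using memI m W(1) I(1) by (simp add: subspace_add)
  next
    fix c x assume "x \<in> complex_hull W I"
    then obtain w u u' where e: "x = w + u + cpx g u'" and m: "w \<in> W" "u \<in> I" "u' \<in> I"
      unfolding complex_hull_def by blast
    have "c *\<^sub>R x = c *\<^sub>R w + c *\<^sub>R u + cpx g (c *\<^sub>R u')"
      using m I by (simp add: e subsetD[OF I(2)] scaleR_add_right)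
    then show "c *\<^sub>R x \<in> complex_hull W I"
      using memI m W(1) I(1) by (simp add: subspace_scale)
  qed
  show "cpx g x \<in> complex_hull W I"
    if J: "\<And>w. w \<in> W \<Longrightarrow> cpx g w \<in> W" and x: "x \<in> complex_hull W I"
  proof -
    obtain w u u' where e: "x = w + u + cpx g u'" and m: "w \<in> W" "u \<in> I" "u' \<in> I"
      using x unfolding complex_hull_def by blast
    have "cpx g x = cpx g w + (- u') + cpx g u"
      using m by (simp add: e subsetD[OF I(2)] subsetD[OF W(2)])
    then show ?thesis using memI[OF J[OF m(1)] subspace_neg[OF I(1) m(3)] m(2)] by simp
  qed
qed

text \<open>The inductive step along the lower central series. As \<open>W\<close> is central, only the brackets among
  \<open>I\<close> and \<open>J I\<close> matter. Those with an entry in \<open>I\<close> lie in \<open>K\<close> by hypothesis, and integrability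
  expresses \<open>[J a, J b]\<close> through \<open>[a, b]\<close>, \<open>J [J a, b]\<close> and \<open>J [a, J b]\<close>.\<close>
lemma br_mem_of_complex_hull:
  assumes I: "I \<subseteq> carr g"
    and W: "W \<subseteq> carr g" "\<And>w x. w \<in> W \<Longrightarrow> x \<in> carr g \<Longrightarrow> br g w x = 0"
    and gen: "carr g = complex_hull W I"
    and K: "subspace K" "\<And>x. x \<in> K \<Longrightarrow> cpx g x \<in> K"
      "\<And>x u. x \<in> carr g \<Longrightarrow> u \<in> I \<Longrightarrow> br g x u \<in> K"
    and x: "x \<in> carr g" and y: "y \<in> carr g"
  shows "br g x y \<in> K"
proof -
  obtain w a a' where x': "x = w + a + cpx g a'" "w \<in> W" "a \<in> I" "a' \<in> I"
    using x gen unfolding complex_hull_def by blast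
  obtain w2 b b' where y': "y = w2 + b + cpx g b'" "w2 \<in> W" "b \<in> I" "b' \<in> I"
    using y gen unfolding complex_hull_def by blast
  have mem: "w \<in> carr g" "a \<in> carr g" "a' \<in> carr g" "w2 \<in> carr g" "b \<in> carr g" "b' \<in> carr g"
    using x' y' I W by auto
  have KI: "br g u t \<in> K" if "u \<in> I" "t \<in> carr g" for u t
    using K(3)[OF that(2,1)] subspace_neg[OF K(1)] br_skew[of u t] that I by auto
  have cent: "br g t w2 = 0" if "t \<in> carr g" for t
    using br_skew[OF that mem(4)] W(2)[OF y'(2) that] by simp
  have e1: "br g x y = br g a b + br g a (cpx g b') + br g (cpx g a') b + br g (cpx g a') (cpx g b')"
    using mem W(2)[OF x'(2)] cent by (simp add: x' y')
  have e2: "br g (cpx g a') (cpx g b') =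
      br g a' b' + cpx g (br g (cpx g a') b') + cpx g (br g a' (cpx g b'))"
    using integrable[OF mem(3,6)] by simp
  show ?thesis
    unfolding e1 e2 using x'(3,4) y'(3,4) mem
    by (auto intro!: subspace_add[OF K(1)] K(2) intro: KI K(3))
qed

text \<open>The central subspace \<open>W\<close> together with the \<open>J\<close>-invariant subspace generated by the \<open>k\<close>-th term of
  the lower central series fills \<open>g\<close> for every \<open>k > 0\<close>; for large \<open>k\<close> only \<open>W\<close> remains.\<close>
lemma nilpotent_complex_hull_eq:
  assumes nil: "nilpotent_lie g"
    and W: "subspace W" "W \<subseteq> carr g" "\<And>w x. w \<in> W \<Longrightarrow> x \<in> carr g \<Longrightarrow> br g w x = 0"
    and gen: "carr g = complex_hull W (lower_central g 1)"
  shows "carr g = W"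
proof -
  note lc = lower_central_subspace[THEN conjunct1] lower_central_subspace[THEN conjunct2]
  have all: "carr g = complex_hull W (lower_central g (Suc k))" for k
  proof (induction k)
    case 0
    then show ?case using gen by simp
  next
    case (Suc k)
    let ?I = "lower_central g (Suc (Suc k))"
    let ?K = "complex_hull {0} ?I"
    have z: "subspace {0 :: 'a}" "{0} \<subseteq> carr g" by (auto simp: subspace_def)
    note K = complex_hull_subspace[OF z lc(1)[of "Suc (Suc k)"] lc(2)]
    have KJ: "cpx g x \<in> ?K" if "x \<in> ?K" for x using K(5)[of x] that by auto
    have brK: "br g x u \<in> ?K" if "x \<in> carr g" "u \<in> lower_central g (Suc k)" for x u
      using br_mem_lower_central[OF that] K(4) by blast
    have "br g x y \<in> ?K" if "x \<in> carr g" "y \<in> carr g" for x y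
      by (rule br_mem_of_complex_hull[OF lc(2) W(2) W(3) Suc.IH K(1) KJ brK that])
    then have "{br g x y | x y. x \<in> carr g \<and> y \<in> lower_central g 0} \<subseteq> ?K" by auto
    then have "lower_central g (Suc 0) \<subseteq> ?K"
      unfolding lower_central.simps(2)[of g 0] by (rule span_minimal[OF _ K(1)])
    then have "lower_central g 1 \<subseteq> ?K" unfolding One_nat_def .
    moreover have "?K \<subseteq> complex_hull W ?I"
      using subspace_0[OF W(1)] unfolding complex_hull_def by blast
    ultimately have sub: "lower_central g 1 \<subseteq> complex_hull W ?I"
      "cpx g ` lower_central g 1 \<subseteq> complex_hull W ?I"
      using KJ by blast+
    note H = complex_hull_subspace[OF W(1,2) lc(1)[of "Suc (Suc k)"] lc(2)]
    have "carr g \<subseteq> complex_hull W ?I"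
    proof
      fix x assume "x \<in> carr g"
      then obtain w u u' where e: "x = w + u + cpx g u'"
        and m: "w \<in> W" "u \<in> lower_central g 1" "u' \<in> lower_central g 1"
        using gen unfolding complex_hull_def by blast
      have "w \<in> complex_hull W ?I" "u \<in> complex_hull W ?I" "cpx g u' \<in> complex_hull W ?I"
        using m sub H(3) by blast+
      then show "x \<in> complex_hull W ?I"
        unfolding e by (intro subspace_add[OF H(1)])
    qed
    then show ?case using H(2) by blast
  qed
  \<comment> \<open>One step further down, so that the statement for positive indices also covers \<open>k = 0\<close>.\<close>
  obtain k where k: "lower_central g k = {0}" using nil unfolding nilpotent_lie_def by blast
  have "lower_central g (Suc k) = {0}"
  proof -
    have "{br g x y | x y. x \<in> carr g \<and> y \<in> lower_central g k} \<subseteq> {0}" unfolding k by auto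
    then have "lower_central g (Suc k) \<subseteq> {0}"
      unfolding lower_central.simps by (rule span_minimal) (simp add: subspace_def)
    then show ?thesis using subspace_0[OF lc(1)] by blast
  qed
  then have "carr g = complex_hull W {0}" using all[of k] by (simp only:)
  moreover have "complex_hull W {0} = W" unfolding complex_hull_def by simp
  ultimately show ?thesis by simp
qed

text \<open>By invariance \<open>\<phi>([w, x], y) = \<phi>(w, [x, y])\<close>, so orthogonality to all brackets is centrality.\<close>
lemma central_if_orthogonal_derived:
  assumes "w \<in> carr g" "\<And>x y. x \<in> carr g \<Longrightarrow> y \<in> carr g \<Longrightarrow> met g w (br g x y) = 0"
    and "x \<in> carr g"
  shows "br g w x = 0"
proof (rule nondegenerate)
  fix y assume "y \<in> carr g"
  then show "met g (br g w x) y = 0" using met_br_right[of w x y] assms by simp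
qed (use assms in simp)

text \<open>A nonzero vector orthogonal to the proper subspace \<open>W + [g, g] + J [g, g]\<close> lies in \<open>W\<close>, since it is
  orthogonal to \<open>[g, g]\<close> and to \<open>J [g, g]\<close>; being orthogonal to \<open>W\<close> as well, it is isotropic.\<close>
lemma exists_central_isotropic:
  assumes "nilpotent_lie g" "\<not> abelian_lie g"
  obtains z where "z \<in> carr g" "z \<noteq> 0" "met g z z = 0"
    "\<And>x. x \<in> carr g \<Longrightarrow> br g z x = 0" "\<And>x. x \<in> carr g \<Longrightarrow> br g (cpx g z) x = 0"
proof -
  define W where
    "W = {w \<in> carr g. (\<forall>x\<in>carr g. br g w x = 0) \<and> (\<forall>x\<in>carr g. br g (cpx g w) x = 0)}"
  have W: "subspace W" "W \<subseteq> carr g" unfolding W_def by (auto simp: subspace_def)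
  let ?S = "complex_hull W (lower_central g 1)"
  note lc = lower_central_subspace[THEN conjunct1] lower_central_subspace[THEN conjunct2]
  note S = complex_hull_subspace[OF W lc(1)[of 1] lc(2)]
  have WJ: "cpx g w \<in> W" if "w \<in> W" for w using that unfolding W_def by auto
  have "?S \<noteq> carr g"
  proof
    assume "?S = carr g"
    then have "carr g = W"
      using nilpotent_complex_hull_eq[OF assms(1) W] unfolding W_def by blast
    then show False using assms(2) unfolding abelian_lie_def W_def by blast
  qed
  then obtain z where z: "z \<in> carr g" "z \<noteq> 0" "\<And>y. y \<in> ?S \<Longrightarrow> met g z y = 0"
    using exists_orthogonal[OF S(1,2)] by blast
  have brS: "br g x y \<in> ?S" if "x \<in> carr g" "y \<in> carr g" for x y
    using br_mem_lower_central[of x y 0] S(4) that by auto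
  have c1: "br g z x = 0" if "x \<in> carr g" for x
    by (rule central_if_orthogonal_derived) (use z brS that in auto)
  have c2: "br g (cpx g z) x = 0" if "x \<in> carr g" for x
  proof (rule central_if_orthogonal_derived)
    fix x y assume xy: "x \<in> carr g" "y \<in> carr g"
    show "met g (cpx g z) (br g x y) = 0"
      using met_cpx_right[of z "br g x y"] z(1) z(3)[OF S(5)[OF WJ brS[OF xy]]] xy by simp
  qed (use z that in auto)
  have "z \<in> W" unfolding W_def using z(1) c1 c2 by auto
  then have "met g z z = 0" using z(3) S(3) by blast
  then show thesis using that z c1 c2 by blast
qed

text \<open>Only \<open>v\<close> has to be found: since \<open>J\<close> is an isometry, the plane of \<open>v\<close> and \<open>J v\<close> is then
  isotropic and dual to that of \<open>z\<close> and \<open>J z\<close>.\<close>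
lemma exists_dual_isotropic:
  assumes z: "z \<in> carr g" "z \<noteq> 0" "met g z z = 0"
  obtains v where "v \<in> carr g" "met g z v = 1" "met g (cpx g z) v = 0" "met g v v = 0"
proof -
  obtain y where y: "y \<in> carr g" "met g z y \<noteq> 0" using nondegenerate[OF z(1)] z(2) by blast
  let ?a = "met g z y" and ?b = "met g (cpx g z) y"
  \<comment> \<open>The combination of \<open>y\<close> and \<open>J y\<close> that is normalised against \<open>z\<close> and orthogonal to \<open>J z\<close>:
     dividing by the complex number with real and imaginary parts \<open>\<phi>(z, y)\<close> and \<open>\<phi>(J z, y)\<close>.\<close>
  define u where "u = (1 / (?a\<^sup>2 + ?b\<^sup>2)) *\<^sub>R (?a *\<^sub>R y - ?b *\<^sub>R cpx g y)"
  have u: "u \<in> carr g" unfolding u_def using y by simp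
  have nz: "?a\<^sup>2 + ?b\<^sup>2 \<noteq> 0" using y(2) by (simp add: sum_power2_eq_zero_iff)
  have u1: "met g z u = 1"
    unfolding u_def using y z nz
    by (simp add: met_cpx_right[of z y] power2_eq_square)
  have u2: "met g (cpx g z) u = 0"
    unfolding u_def using y z by simp
  \<comment> \<open>Adding a multiple of the isotropic \<open>z\<close> makes the vector isotropic and keeps the two pairings.\<close>
  define v where "v = u - (met g u u / 2) *\<^sub>R z"
  show thesis
  proof (rule that[of v])
    show "v \<in> carr g" "met g z v = 1" "met g (cpx g z) v = 0"
      unfolding v_def using u z u1 u2 by auto
    show "met g v v = 0"
      unfolding v_def using u z u1 met_sym[of u z] by (simp add: algebra_simps)
  qed
qed

section \<open>Reduction to a complex subspace\<close>

definition reduction :: "'a set \<Rightarrow> ('a \<Rightarrow> 'a) \<Rightarrow> 'a phq" where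
  "reduction H p = \<lparr> carr = H, br = (\<lambda>x y. p (br g x y)), cpx = cpx g, met = met g \<rparr>"

lemma reduction_sel [simp]:
  "carr (reduction H p) = H" "br (reduction H p) = (\<lambda>x y. p (br g x y))"
  "cpx (reduction H p) = cpx g" "met (reduction H p) = met g"
  by (simp_all add: reduction_def)

text \<open>Here \<open>p\<close> is adjoint to the inclusion of \<open>H\<close>, so it transports invariance and nondegeneracy, and
  commutes with \<open>J\<close>, so it transports integrability. The condition \<open>absorb\<close> replaces the requirement that
  \<open>p\<close> be a homomorphism, which fails in the application: it suffices that dropping the inner
  projection of an iterated bracket changes nothing.\<close>
lemma phq_reduction:
  assumes H: "subspace H" "H \<subseteq> carr g" "\<And>x. x \<in> H \<Longrightarrow> cpx g x \<in> H"
    and p: "linear_between (carr g) H p" "\<And>x. x \<in> carr g \<Longrightarrow> p (cpx g x) = cpx g (p x)"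
    and adj: "\<And>x y. x \<in> H \<Longrightarrow> y \<in> carr g \<Longrightarrow> met g x (p y) = met g x y"
    and absorb: "\<And>x y w. x \<in> H \<Longrightarrow> y \<in> H \<Longrightarrow> w \<in> H \<Longrightarrow>
        p (br g x (p (br g y w))) = p (br g x (br g y w))"
  shows "phq_lie_algebra (reduction H p)"
proof -
  note lin = linear_betweenD[OF p(1)]
  have Hc: "x \<in> H \<Longrightarrow> x \<in> carr g" for x using H(2) by auto
  have p0: "p 0 = 0" using lin(3)[of 0 0] by simp
  have pd: "p (x - y) = p x - p y" if "x \<in> carr g" "y \<in> carr g" for x y
    using lin(2)[of "x - y" y] that by (simp add: algebra_simps)
  obtain A where A: "finite A" "span A = carr g" using finite_dim by blast
  have "\<exists>B. finite B \<and> span B = H"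
    using finite_basis_of_subspace[OF H(1), of A] A H(2) by metis
  moreover have "p (br g x (p (br g y w))) + p (br g y (p (br g w x)))
      + p (br g w (p (br g x y))) = 0" if "x \<in> H" "y \<in> H" "w \<in> H" for x y w
  proof -
    have "p (br g x (br g y w) + br g y (br g w x) + br g w (br g x y)) = 0"
      using jacobi[of x y w] that Hc p0 by simp
    then show ?thesis using that Hc by (simp add: absorb lin(2))
  qed
  ultimately have lie: "lie_algebra (reduction H p)"
    unfolding lie_algebra_def bilinear_between_def linear_between_def
    using H(1) Hc lin p0 by auto
  have "p (br g x y) + cpx g (p (br g (cpx g x) y)) + cpx g (p (br g x (cpx g y)))
      - p (br g (cpx g x) (cpx g y)) = 0" if "x \<in> H" "y \<in> H" for x y
  proof -
    have "p (br g x y + cpx g (br g (cpx g x) y) + cpx g (br g x (cpx g y))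
        - br g (cpx g x) (cpx g y)) = 0"
      using integrable[of x y] that Hc p0 by simp
    then show ?thesis using that Hc by (simp add: lin(2) pd p(2))
  qed
  then have cs: "complex_structure (reduction H p)"
    unfolding complex_structure_def linear_between_def using H(3) Hc by auto
  have nd: "x = 0" if x: "x \<in> H" "\<forall>y\<in>H. met g x y = 0" for x
  proof (rule nondegenerate)
    show "x \<in> carr g" using x Hc by auto
    fix y assume "y \<in> carr g"
    then show "met g x y = 0" using adj[OF x(1), of y] x(2) lin(1) by auto
  qed
  have inv: "met g (p (br g x y)) w + met g y (p (br g x w)) = 0"
    if "x \<in> H" "y \<in> H" "w \<in> H" for x y w
    using that Hc adj[of w "br g x y"] adj[of y "br g x w"] invariant[of x y w]
      met_sym[of w "p (br g x y)"] met_sym[of w "br g x y"] lin(1)[of "br g x y"]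
    by auto
  have "bilinear_between H UNIV (met g)"
    unfolding bilinear_between_def linear_between_def using Hc by simp
  then have "quadratic_structure (reduction H p)"
    unfolding quadratic_structure_def reduction_sel using Hc nd inv met_sym by blast
  then show ?thesis
    unfolding phq_lie_algebra_def using lie cs Hc by auto
qed

end

section \<open>Hyperbolic planes and double extensions\<close>

locale central_hyperbolic = phq_algebra +
  fixes z v :: 'a
  assumes z_mem [simp]: "z \<in> carr g" and v_mem [simp]: "v \<in> carr g"
    and br_z [simp]: "x \<in> carr g \<Longrightarrow> br g z x = 0"
    and br_Jz [simp]: "x \<in> carr g \<Longrightarrow> br g (cpx g z) x = 0"
    and met_z_z [simp]: "met g z z = 0" and met_v_v [simp]: "met g v v = 0"
    and met_z_v [simp]: "met g z v = 1" and met_Jz_v [simp]: "met g (cpx g z) v = 0"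
begin

lemma br_z_right [simp]:
  "x \<in> carr g \<Longrightarrow> br g x z = 0" "x \<in> carr g \<Longrightarrow> br g x (cpx g z) = 0"
  using br_skew[of x z] br_skew[of x "cpx g z"] by auto

lemma met_frame [simp]:
  "met g v z = 1" "met g v (cpx g z) = 0" "met g z (cpx g v) = 0" "met g (cpx g v) z = 0"
  using met_sym[of v z] met_sym[of v "cpx g z"] met_cpx_right[of z v] met_sym[of z "cpx g v"]
  by auto

text \<open>Brackets are orthogonal to the central vectors \<open>z\<close> and \<open>J z\<close>, that is, they have no component along
  \<open>v\<close> and \<open>J v\<close>.\<close>
lemma met_br_z [simp]:
  assumes "x \<in> carr g" "y \<in> carr g"
  shows "met g (br g x y) z = 0" "met g (br g x y) (cpx g z) = 0"
    "met g z (br g x y) = 0" "met g (cpx g z) (br g x y) = 0"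
  using met_br_right[of z x y] met_br_right[of "cpx g z" x y] met_sym[of "br g x y" z]
    met_sym[of "br g x y" "cpx g z"] assms by auto

lemma met_br_self [simp]:
  assumes "x \<in> carr g" "y \<in> carr g"
  shows "met g (br g x y) y = 0" "met g (br g x y) x = 0"
    "met g y (br g x y) = 0" "met g x (br g x y) = 0"
proof -
  show "met g (br g x y) y = 0" using met_br_right[of x y y] assms by simp
  show "met g x (br g x y) = 0" using met_br_right[of x x y] assms by simp
  then show "met g (br g x y) x = 0" using met_sym assms by simp
  show "met g y (br g x y) = 0" using \<open>met g (br g x y) y = 0\<close> met_sym assms by simp
qed

text \<open>The orthogonal projection to the complement of the hyperbolic space of \<open>z, J z, J v, v\<close>.\<close>
definition proj :: "'a \<Rightarrow> 'a" where
  "proj x = x - met g x v *\<^sub>R z - met g x (cpx g v) *\<^sub>R cpx g z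
      - met g x (cpx g z) *\<^sub>R cpx g v - met g x z *\<^sub>R v"

definition H :: "'a set" where
  "H = {x \<in> carr g. met g x z = 0 \<and> met g x (cpx g z) = 0 \<and>
      met g x v = 0 \<and> met g x (cpx g v) = 0}"

abbreviation h :: "'a phq" where "h \<equiv> reduction H proj"

lemma H_subspace: "subspace H"
  by (auto simp: H_def subspace_def)

lemma cpx_H [simp]: "x \<in> H \<Longrightarrow> cpx g x \<in> H"
  using met_cpx_right[of x z] met_cpx_right[of x v] by (auto simp: H_def)

lemma proj_mem [simp]: "x \<in> carr g \<Longrightarrow> proj x \<in> H"
  by (simp add: proj_def H_def)

lemma br_v_cpx_v_mem [simp]: "br g v (cpx g v) \<in> H"
  by (simp add: H_def)

lemma H_mem [simp]: "x \<in> H \<Longrightarrow> x \<in> carr g"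
  unfolding H_def by blast

lemma H_orthogonal [simp]:
  assumes "x \<in> H"
  shows "met g x z = 0" "met g x (cpx g z) = 0" "met g x v = 0" "met g x (cpx g v) = 0"
    "met g z x = 0" "met g (cpx g z) x = 0" "met g v x = 0" "met g (cpx g v) x = 0"
proof -
  show 1: "met g x z = 0" "met g x (cpx g z) = 0" "met g x v = 0" "met g x (cpx g v) = 0"
    using assms unfolding H_def by blast+
  show "met g z x = 0" "met g (cpx g z) x = 0" "met g v x = 0" "met g (cpx g v) x = 0"
    using 1 met_sym[OF H_mem[OF assms]] by simp_all
qed

lemma proj_H [simp]: "x \<in> H \<Longrightarrow> proj x = x"
  by (simp add: proj_def)

lemma proj_linear [simp]:
  "x \<in> carr g \<Longrightarrow> y \<in> carr g \<Longrightarrow> proj (x + y) = proj x + proj y"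
  "x \<in> carr g \<Longrightarrow> proj (c *\<^sub>R x) = c *\<^sub>R proj x"
  by (simp_all add: proj_def algebra_simps)

lemma proj_diff [simp]:
  "x \<in> carr g \<Longrightarrow> y \<in> carr g \<Longrightarrow> proj (x - y) = proj x - proj y"
  using proj_linear(1)[of "x - y" y] by (simp add: algebra_simps)

lemma proj_cpx [simp]: "x \<in> carr g \<Longrightarrow> proj (cpx g x) = cpx g (proj x)"
  using met_cpx_right[of x v] met_cpx_right[of x z]
  by (simp add: proj_def algebra_simps)

lemma met_proj [simp]:
  assumes "x \<in> H" "y \<in> carr g"
  shows "met g x (proj y) = met g x y" "met g (proj y) x = met g y x"
  using assms by (simp_all add: proj_def)

text \<open>On the complement of \<open>z\<close> and \<open>J z\<close>, which contains all brackets, the projection only removes central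
  components. Hence inner projections may be dropped in iterated brackets, which is what makes the
  Lie identities pass to \<open>H\<close>.\<close>
lemma br_proj [simp]:
  assumes "x \<in> carr g" "y \<in> carr g" "met g y z = 0" "met g y (cpx g z) = 0"
  shows "br g x (proj y) = br g x y" "br g (proj y) x = br g y x"
  using assms by (simp_all add: proj_def)

lemma proj_decomposition:
  "x = met g x v *\<^sub>R z + met g x (cpx g v) *\<^sub>R cpx g z + proj x
      + met g x (cpx g z) *\<^sub>R cpx g v + met g x z *\<^sub>R v"
  by (simp add: proj_def)

lemma phq_h: "phq_lie_algebra h"
  by (rule phq_reduction)
    (auto simp: H_subspace linear_between_def)

text \<open>The four orthogonality conditions are imposed one at a time; each is independent of those before,
  as the dual vector of the frame still satisfies the earlier conditions but not the new one.\<close>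
lemma dim_h: "dim (carr g) = dim (carr h) + 4"
proof -
  obtain A where A: "finite A" "span A = carr g" using finite_dim by blast
  have hyp: "subspace {x \<in> V. met g x w = 0} \<and> dim V = Suc (dim {x \<in> V. met g x w = 0})"
    if "subspace V" "V \<subseteq> carr g" "w \<in> carr g" "u \<in> V" "met g u w \<noteq> 0" for V w u
    using dim_hyperplane[of V A "\<lambda>x. met g x w" u] that A linear_met_left[OF that(3)]
    by (auto simp: linear_between_def subset_iff)
  define V1 where "V1 = {x \<in> carr g. met g x z = 0}"
  define V2 where "V2 = {x \<in> V1. met g x (cpx g z) = 0}"
  define V3 where "V3 = {x \<in> V2. met g x v = 0}"
  have d1: "subspace V1 \<and> dim (carr g) = Suc (dim V1)"
    unfolding V1_def by (rule hyp[where u = v]) (simp_all add: subspace_carr)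
  have d2: "subspace V2 \<and> dim V1 = Suc (dim V2)"
    unfolding V2_def by (rule hyp[where u = "cpx g v"]) (use d1 in \<open>auto simp: V1_def\<close>)
  have d3: "subspace V3 \<and> dim V2 = Suc (dim V3)"
    unfolding V3_def by (rule hyp[where u = z]) (use d2 in \<open>auto simp: V1_def V2_def\<close>)
  have "dim V3 = Suc (dim {x \<in> V3. met g x (cpx g v) = 0})"
    by (rule hyp[where u = "cpx g z", THEN conjunct2])
      (use d3 in \<open>auto simp: V1_def V2_def V3_def\<close>)
  moreover have "{x \<in> V3. met g x (cpx g v) = 0} = H"
    unfolding V1_def V2_def V3_def H_def by blast
  ultimately show ?thesis using d1 d2 d3 by simp
qed

text \<open>The lower central series of \<open>h\<close> is covered by the projections of the elements of the lower
  central series of \<open>g\<close> that are orthogonal to \<open>z\<close> and \<open>J z\<close>. Restricting to such elements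
  matters for the initial term only, and there allows the inner projection to be dropped.\<close>
lemma nilpotent_h:
  assumes "nilpotent_lie g"
  shows "nilpotent_lie h"
proof -
  define Q where
    "Q k = proj ` {u \<in> lower_central g k. met g u z = 0 \<and> met g u (cpx g z) = 0}" for k
  have sub: "lower_central h k \<subseteq> Q k" for k
  proof (induction k)
    case 0
    show ?case
    proof
      fix x assume "x \<in> lower_central h 0"
      then have "x \<in> H" by simp
      then show "x \<in> Q 0" unfolding Q_def by (intro image_eqI[of _ _ x]) auto
    qed
  next
    case (Suc k)
    note lc = lower_central_subspace[THEN conjunct1] lower_central_subspace[THEN conjunct2]
    have lcm: "u \<in> lower_central g j \<Longrightarrow> u \<in> carr g" for u j using lc(2) by blast
    have "subspace (Q (Suc k))"
    proof (rule subspaceI)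
      show "0 \<in> Q (Suc k)"
        unfolding Q_def
        by (rule image_eqI[of _ _ 0])
          (auto simp: H_subspace subspace_0 subspace_0[OF lc(1)] simp del: lower_central.simps)
    next
      fix x y assume "x \<in> Q (Suc k)" "y \<in> Q (Suc k)"
      then obtain a b where "x = proj a" "y = proj b"
        "a \<in> lower_central g (Suc k)" "met g a z = 0" "met g a (cpx g z) = 0"
        "b \<in> lower_central g (Suc k)" "met g b z = 0" "met g b (cpx g z) = 0"
        unfolding Q_def by blast
      then show "x + y \<in> Q (Suc k)" unfolding Q_def
        by (intro image_eqI[of _ _ "a + b"])
          (auto simp: lcm subspace_add[OF lc(1)] simp del: lower_central.simps)
    next
      fix c x assume "x \<in> Q (Suc k)"
      then obtain a where "x = proj a"
        "a \<in> lower_central g (Suc k)" "met g a z = 0" "met g a (cpx g z) = 0"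
        unfolding Q_def by blast
      then show "c *\<^sub>R x \<in> Q (Suc k)" unfolding Q_def
        by (intro image_eqI[of _ _ "c *\<^sub>R a"])
          (auto simp: lcm subspace_scale[OF lc(1)] simp del: lower_central.simps)
    qed
    moreover have "{br h x y | x y. x \<in> carr h \<and> y \<in> lower_central h k} \<subseteq> Q (Suc k)"
    proof clarify
      fix x y assume x: "x \<in> carr h" and "y \<in> lower_central h k"
      then obtain u where u: "y = proj u" "u \<in> lower_central g k" "met g u z = 0"
        "met g u (cpx g z) = 0"
        using Suc unfolding Q_def by blast
      have "br h x y = proj (br g x u)" using x u lcm by simp
      moreover have "br g x u \<in> lower_central g (Suc k)"
        using br_mem_lower_central[of x u k] x u by simp
      ultimately show "br h x y \<in> Q (Suc k)"
        unfolding Q_def using x u lcm[of u k]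
        by (intro image_eqI[of _ _ "br g x u"]) (auto simp del: lower_central.simps)
    qed
    ultimately show ?case unfolding lower_central.simps(2)[of h] by (rule span_minimal[rotated])
  qed
  obtain k where "lower_central g k = {0}" using assms unfolding nilpotent_lie_def by blast
  then have "Q k \<subseteq> {0}" unfolding Q_def by (auto simp: H_subspace subspace_0)
  then have "lower_central h k \<subseteq> {0}" using sub by blast
  moreover have "0 \<in> lower_central h k"
    using phq_algebra.lower_central_subspace[of h k] phq_h subspace_0
    unfolding phq_algebra_def by blast
  ultimately show ?thesis unfolding nilpotent_lie_def by blast
qed

abbreviation D :: "'a \<Rightarrow> 'a" where "D x \<equiv> proj (br g (cpx g v) x)"
abbreviation F :: "'a \<Rightarrow> 'a" where "F x \<equiv> proj (br g v x)"
abbreviation s :: 'a where "s \<equiv> br g v (cpx g v)"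

text \<open>The map \<open>ad w\<close> is a skew derivation of \<open>g\<close>, and projecting it preserves both properties.\<close>
lemma skew_derivation_proj_br:
  assumes "w \<in> carr g"
  shows "skew_derivation h (\<lambda>x. proj (br g w x))"
proof -
  have "proj (br g w (proj (br g x y))) =
      proj (br g (proj (br g w x)) y) + proj (br g x (proj (br g w y)))"
    if "x \<in> H" "y \<in> H" for x y
    using that assms leibniz[of w x y] by simp
  moreover have "met g (br g w x) y = - met g x (br g w y)" if "x \<in> H" "y \<in> H" for x y
    using invariant[of w x y] that assms by simp
  ultimately show ?thesis
    unfolding skew_derivation_def linear_between_def using assms by simp
qed

text \<open>The condition that \<open>F + J D\<close> commutes with \<open>J\<close> is integrability at \<open>v\<close> and \<open>x\<close>, multiplied by \<open>J\<close> and
  projected; the commutator of \<open>F\<close> and \<open>D\<close> comes from \<open>[ad v, ad (J v)] = ad [v, J v]\<close>.\<close>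
lemma extension_data_h: "extension_data h D F s"
proof -
  have "F (cpx g x) + cpx g (D (cpx g x)) = cpx g (F x + cpx g (D x))" if x: "x \<in> H" for x
  proof -
    have xc: "x \<in> carr g" using x by simp
    have "proj (cpx g (br g v x + cpx g (br g (cpx g v) x) + cpx g (br g v (cpx g x))
          - br g (cpx g v) (cpx g x))) = 0"
      using integrable[OF v_mem xc] by (simp add: H_subspace subspace_0)
    then show ?thesis using xc by (simp add: algebra_simps)
  qed
  moreover have "F (D x) - D (F x) = proj (br g s x)" if x: "x \<in> H" for x
    using leibniz[of v "cpx g v" x] x by simp
  ultimately show ?thesis
    unfolding extension_data_def using skew_derivation_proj_br by simp
qed

text \<open>The coefficients along \<open>z, J z\<close>, the component in \<open>H\<close>, and the coefficients along \<open>J v, v\<close>: each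
  coefficient is read off by pairing with the dual vector of the frame.\<close>
definition coordinates :: "'a \<Rightarrow> real \<times> real \<times> 'a \<times> real \<times> real" where
  "coordinates x = (met g x v, met g x (cpx g v), proj x, met g x (cpx g z), met g x z)"

lemma br_decomposition:
  assumes "X \<in> carr g" "Y \<in> carr g"
  defines "x \<equiv> proj X" and "b' \<equiv> met g X (cpx g z)" and "b \<equiv> met g X z"
    and "y \<equiv> proj Y" and "d' \<equiv> met g Y (cpx g z)" and "d \<equiv> met g Y z"
  shows "br g X Y = br g x y + (b * d' - b' * d) *\<^sub>R s
      + b *\<^sub>R br g v y - d *\<^sub>R br g v x + b' *\<^sub>R br g (cpx g v) y - d' *\<^sub>R br g (cpx g v) x"
proof -
  have m: "x \<in> carr g" "y \<in> carr g" using assms by (simp_all add: x_def y_def)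
  have "br g X Y = br g (met g X v *\<^sub>R z + met g X (cpx g v) *\<^sub>R cpx g z + x + b' *\<^sub>R cpx g v + b *\<^sub>R v)
     (met g Y v *\<^sub>R z + met g Y (cpx g v) *\<^sub>R cpx g z + y + d' *\<^sub>R cpx g v + d *\<^sub>R v)"
    unfolding b_def b'_def d_def d'_def x_def y_def
    using proj_decomposition[of X] proj_decomposition[of Y] by simp
  also have "\<dots> = br g x y + d' *\<^sub>R br g x (cpx g v) + d *\<^sub>R br g x v
      + b' *\<^sub>R br g (cpx g v) y + (b' * d) *\<^sub>R br g (cpx g v) v
      + b *\<^sub>R br g v y + (b * d') *\<^sub>R s"
    using m by (simp add: algebra_simps)
  finally show ?thesis
    using br_skew[of x "cpx g v"] br_skew[of x v] br_skew[of "cpx g v" v] m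
    by (simp add: algebra_simps)
qed

text \<open>For the bracket, the coefficients along \<open>z\<close> and \<open>J z\<close> are its pairings with \<open>v\<close> and \<open>J v\<close>. Invariance turns
  them into the values \<open>\<phi>(F x, y)\<close>, \<open>\<phi>(D x, y)\<close> and the pairings with \<open>s\<close> that define the double extension.\<close>
lemma coordinates_equivalence: "phq_equivalent g (double_extension h D F s)"
proof -
  let ?E = "double_extension h D F s"
  have carrE: "carr ?E = UNIV \<times> UNIV \<times> H \<times> UNIV \<times> UNIV"
    by (simp add: double_extension_def)
  have lin: "linear_between (carr g) (carr ?E) coordinates"
    unfolding linear_between_def carrE by (simp add: coordinates_def)
  define inv where
    "inv = (\<lambda>(a, a', x, b', b). a *\<^sub>R z + a' *\<^sub>R cpx g z + x + b' *\<^sub>R cpx g v + b *\<^sub>R v)"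
  have bij: "bij_betw coordinates (carr g) (carr ?E)"
  proof (rule bij_betw_byWitness[where f' = inv])
    show "\<forall>x\<in>carr g. inv (coordinates x) = x"
      using proj_decomposition by (simp add: inv_def coordinates_def)
    show "coordinates ` carr g \<subseteq> carr ?E" unfolding carrE by (auto simp: coordinates_def)
    show "inv ` carr ?E \<subseteq> carr g" unfolding carrE by (auto simp: inv_def)
    show "\<forall>t\<in>carr ?E. coordinates (inv t) = t"
      unfolding carrE by (auto simp: inv_def coordinates_def proj_def)
  qed
  have "coordinates (br g X Y) = br ?E (coordinates X) (coordinates Y)"
    if XY: "X \<in> carr g" "Y \<in> carr g" for X Y
  proof -
    let ?x = "proj X" and ?y = "proj Y"
    have m: "?x \<in> H" "?y \<in> H" using XY by simp_all
    have 1: "met g (br g x y) w = met g (br g w x) y"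
      if "x \<in> carr g" "y \<in> carr g" "w \<in> carr g" for x y w
      using met_br_right[of w x y] met_sym[of w "br g x y"] that by simp
    have 2: "met g (br g v y) (cpx g v) = - met g s y" if "y \<in> carr g" for y
      using 1[of v y "cpx g v"] br_skew[of v "cpx g v"] that by simp
    have 3: "met g (br g (cpx g v) y) v = met g s y" if "y \<in> carr g" for y
      using 1[of "cpx g v" y v] that by simp
    have 4: "met g (proj w) (proj Y) = met g w (proj Y)" if "w \<in> carr g" for w
      by (rule met_proj(2)[OF m(2) that])
    show ?thesis
      using m XY
      by (simp add: coordinates_def double_extension_def br_decomposition[OF XY] 2 3 4
          1[of ?x ?y v] 1[of ?x ?y "cpx g v"] del: met_proj)
  qed
  moreover have "cpx ?E (coordinates x) = coordinates (cpx g x)" if "x \<in> carr g" for x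
    using that met_cpx_right[of x v] met_cpx_right[of x z]
    by (simp add: coordinates_def double_extension_def)
  moreover have "met ?E (coordinates X) (coordinates Y) = met g X Y"
    if XY: "X \<in> carr g" "Y \<in> carr g" for X Y
  proof -
    have m: "proj X \<in> H" "proj Y \<in> H" using XY by simp_all
    have "met g X Y = met g (met g X v *\<^sub>R z + met g X (cpx g v) *\<^sub>R cpx g z + proj X
          + met g X (cpx g z) *\<^sub>R cpx g v + met g X z *\<^sub>R v)
        (met g Y v *\<^sub>R z + met g Y (cpx g v) *\<^sub>R cpx g z + proj Y
          + met g Y (cpx g z) *\<^sub>R cpx g v + met g Y z *\<^sub>R v)"
      using proj_decomposition[of X] proj_decomposition[of Y] by simp
    also have "\<dots> = met g X v * met g Y z + met g X (cpx g v) * met g Y (cpx g z)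
        + met g (proj X) (proj Y) + met g X (cpx g z) * met g Y (cpx g v) + met g X z * met g Y v"
      using m XY by (simp del: met_proj)
    finally show ?thesis
      by (simp add: coordinates_def double_extension_def algebra_simps del: met_proj)
  qed
  ultimately show ?thesis unfolding phq_equivalent_def using lin bij by blast
qed

lemma is_double_extension_h: "is_double_extension_of g h"
  unfolding is_double_extension_of_def
  using phq phq_h extension_data_h coordinates_equivalence by blast

end

section \<open>Existence of double extensions and of definite planes\<close>

context phq_algebra
begin

lemma double_extension_of_central_isotropic:
  assumes nil: "nilpotent_lie g"
    and z: "z \<in> carr g" "z \<noteq> 0" "met g z z = 0"
    and central: "\<And>x. x \<in> carr g \<Longrightarrow> br g z x = 0"
      "\<And>x. x \<in> carr g \<Longrightarrow> br g (cpx g z) x = 0"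
  obtains h :: "'a phq" where "phq_lie_algebra h" "nilpotent_lie h"
    "dim (carr g) = dim (carr h) + 4" "is_double_extension_of g h"
proof -
  obtain v where v: "v \<in> carr g" "met g z v = 1" "met g (cpx g z) v = 0" "met g v v = 0"
    using exists_dual_isotropic[OF z] .
  interpret central_hyperbolic g z v
    by unfold_locales (use z central v in auto)
  show thesis
    by (rule that[OF phq_h nilpotent_h[OF nil] dim_h is_double_extension_h])
qed

text \<open>The plane of \<open>e\<close> and \<open>J e\<close> carries \<open>\<phi>(e, e)\<close> times the Euclidean metric, because \<open>J e\<close> is orthogonal to
  \<open>e\<close> and has the same square. It is definite, so it splits off orthogonally; in the abelian case this is a
  splitting of Lie algebras.\<close>
lemma abelian_orthogonal_plane:
  assumes ab: "abelian_lie g" and e: "e \<in> carr g" "met g e e \<noteq> 0"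
  shows "\<exists>(h :: 'a phq) (r :: (real \<times> real) phq).
      phq_lie_algebra h \<and> nilpotent_lie h \<and> dim (carr g) = dim (carr h) + 2 \<and>
      phq_lie_algebra r \<and> carr r = UNIV \<and> abelian_lie r \<and> definite_metric r \<and>
      phq_equivalent g (orthogonal_sum h r)"
proof -
  define c where "c = met g e e"
  have c: "c \<noteq> 0" using e(2) by (simp add: c_def)
  have br0: "br g x y = 0" if "x \<in> carr g" "y \<in> carr g" for x y
    using ab that unfolding abelian_lie_def by blast
  define P where "P = {x \<in> carr g. met g x e = 0 \<and> met g x (cpx g e) = 0}"
  define q where "q x = x - (met g x e / c) *\<^sub>R e - (met g x (cpx g e) / c) *\<^sub>R cpx g e" for x
  have P_sub: "subspace P" using e(1) by (auto simp: P_def subspace_def)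
  have P_carr: "x \<in> carr g" if "x \<in> P" for x using that unfolding P_def by blast
  have P_orth: "met g x e = 0" "met g x (cpx g e) = 0" if "x \<in> P" for x
    using that unfolding P_def by blast+
  have P_cpx: "cpx g x \<in> P" if "x \<in> P" for x
    using P_orth[OF that] P_carr[OF that] met_cpx_right[OF P_carr[OF that] e(1)]
    by (simp add: P_def e)
  have q_mem: "q x \<in> P" if "x \<in> carr g" for x
    using that e c by (simp add: q_def P_def c_def)
  have q_cpx: "q (cpx g x) = cpx g (q x)" if "x \<in> carr g" for x
    using that e met_cpx_right[OF that e(1)] by (simp add: q_def algebra_simps)
  have q_lin: "q (x + y) = q x + q y" "q (k *\<^sub>R x) = k *\<^sub>R q x"
    if "x \<in> carr g" "y \<in> carr g" for x y k
    using that e by (simp_all add: q_def algebra_simps add_divide_distrib)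
  have q0: "q 0 = 0" using e by (simp add: q_def)
  have q_adj: "met g x (q y) = met g x y" if "x \<in> P" "y \<in> carr g" for x y
    using that e P_carr P_orth by (simp add: q_def)
  define h where "h = reduction P q"
  have h: "phq_lie_algebra h"
    unfolding h_def
    by (rule phq_reduction) (use P_sub P_carr P_cpx q_mem q_cpx q_lin q_adj q0 br0 in
        \<open>auto simp: linear_between_def\<close>)
  have br_h: "br h x y = 0" if "x \<in> P" "y \<in> P" for x y
    using br0 P_carr that q0 by (simp add: h_def)
  have "lower_central h 1 \<subseteq> {0}"
    unfolding One_nat_def lower_central.simps
    by (rule span_minimal) (use br_h in \<open>auto simp: h_def subspace_def\<close>)
  moreover have "0 \<in> lower_central h 1" by (simp add: span_zero)
  ultimately have nil_h: "nilpotent_lie h" unfolding nilpotent_lie_def by blast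
  have dim: "dim (carr g) = dim (carr h) + 2"
  proof -
    obtain A where A: "finite A" "span A = carr g" using finite_dim by blast
    let ?V = "{x \<in> carr g. met g x e = 0}"
    have d1: "subspace ?V" "dim (carr g) = Suc (dim ?V)"
      using dim_hyperplane[OF subspace_carr _ A(1) linear_met_left[OF e(1)] e] A(2) by auto
    have f: "linear_between ?V UNIV (\<lambda>x. met g x (cpx g e))"
      by (auto simp: linear_between_def e)
    have "dim ?V = Suc (dim {x \<in> ?V. met g x (cpx g e) = 0})"
      by (rule dim_hyperplane(2)[OF d1(1) _ A(1) f, of "cpx g e"]) (use A(2) e in auto)
    moreover have "{x \<in> ?V. met g x (cpx g e) = 0} = P" unfolding P_def by blast
    ultimately show ?thesis using d1 by (simp add: h_def)
  qed
  define r :: "(real \<times> real) phq" where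
    "r = \<lparr> carr = UNIV, br = (\<lambda>_ _. 0), cpx = (\<lambda>(a, b). (- b, a)),
        met = (\<lambda>(a, b) (a', b'). c * (a * a' + b * b')) \<rparr>"
  have "\<exists>B :: (real \<times> real) set. finite B \<and> span B = UNIV"
    using finite_Basis span_Basis by blast
  then have r_lie: "lie_algebra r"
    by (auto simp: lie_algebra_def r_def bilinear_between_def linear_between_def)
  have r_cs: "complex_structure r"
    by (auto simp: complex_structure_def r_def linear_between_def zero_prod_def)
  have "x = 0" if "\<forall>y. met r x y = 0" for x
  proof -
    obtain a b where x: "x = (a, b)" by (cases x)
    have "met r x (a, b) = 0" using that by blast
    then show ?thesis using c by (simp add: x r_def zero_prod_def sum_squares_eq_zero_iff)
  qed
  moreover have "bilinear_between UNIV UNIV (met r)"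
    by (auto simp: r_def bilinear_between_def linear_between_def algebra_simps)
  moreover have "met r x y = met r y x" for x y
    by (simp add: r_def case_prod_beta algebra_simps)
  ultimately have r_q: "quadratic_structure r"
    unfolding quadratic_structure_def by (auto simp: r_def zero_prod_def)
  have r: "phq_lie_algebra r"
    unfolding phq_lie_algebra_def using r_lie r_cs r_q by (auto simp: r_def algebra_simps)
  have pos: "a * a + b * b > 0" if "(a, b) \<noteq> 0" for a b :: real
    using that by (auto simp: zero_prod_def sum_squares_gt_zero_iff)
  have r_def': "definite_metric r"
    unfolding definite_metric_def using c pos
    by (cases "c > 0") (auto simp: r_def zero_less_mult_iff mult_less_0_iff)
  define \<psi> where "\<psi> x = (q x, met g x e / c, met g x (cpx g e) / c)" for x
  define \<psi>' where "\<psi>' = (\<lambda>(x, a, b). x + a *\<^sub>R e + b *\<^sub>R cpx g e)"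
  let ?S = "orthogonal_sum h r"
  have carrS: "carr ?S = P \<times> UNIV" by (simp add: orthogonal_sum_def h_def r_def)
  have "linear_between (carr g) (carr ?S) \<psi>"
    unfolding linear_between_def carrS using q_mem q_lin e
    by (simp add: \<psi>_def add_divide_distrib)
  moreover have "bij_betw \<psi> (carr g) (carr ?S)"
  proof (rule bij_betw_byWitness[where f' = \<psi>'])
    show "\<forall>x\<in>carr g. \<psi>' (\<psi> x) = x" by (simp add: \<psi>_def \<psi>'_def q_def)
    show "\<psi> ` carr g \<subseteq> carr ?S" unfolding carrS using q_mem by (auto simp: \<psi>_def)
    show "\<psi>' ` carr ?S \<subseteq> carr g" unfolding carrS using P_carr e by (auto simp: \<psi>'_def)
    show "\<forall>t\<in>carr ?S. \<psi> (\<psi>' t) = t"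
      unfolding carrS using P_carr P_orth e c
      by (auto simp: \<psi>_def \<psi>'_def q_def c_def)
  qed
  moreover have "\<psi> (br g x y) = br ?S (\<psi> x) (\<psi> y)" if "x \<in> carr g" "y \<in> carr g" for x y
    using br0[OF that] br_h q_mem that e q0
    by (simp add: \<psi>_def orthogonal_sum_def r_def zero_prod_def)
  moreover have "cpx ?S (\<psi> x) = \<psi> (cpx g x)" if "x \<in> carr g" for x
    using that e met_cpx_right[OF that e(1)] q_cpx
    by (simp add: \<psi>_def orthogonal_sum_def r_def h_def)
  moreover have "met ?S (\<psi> x) (\<psi> y) = met g x y" if "x \<in> carr g" "y \<in> carr g" for x y
  proof -
    have m: "q x \<in> P" "q y \<in> carr g" using q_mem P_carr that by auto
    have "met g (q x) (q y) = met g (q x) y" using q_adj m(1) that by simp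
    also have "\<dots> = met g x y - met g x e * met g y e / c - met g x (cpx g e) * met g y (cpx g e) / c"
      using that e met_sym[of e y] met_sym[of "cpx g e" y] by (simp add: q_def)
    finally have "met g x y = met g (q x) (q y)
        + c * (met g x e / c * (met g y e / c) + met g x (cpx g e) / c * (met g y (cpx g e) / c))"
      using c by (simp add: distrib_left)
    then show ?thesis by (simp add: \<psi>_def orthogonal_sum_def r_def h_def)
  qed
  ultimately have "phq_equivalent g ?S" unfolding phq_equivalent_def by blast
  then show ?thesis
    using h nil_h dim r r_def' by (intro exI[of _ h] exI[of _ r]) (simp add: r_def abelian_lie_def)
qed

end

lemma nonabelian_double_extension:
  fixes g :: "'a::real_vector phq"
  assumes "phq_lie_algebra g" "nilpotent_lie g" "\<not> abelian_lie g"
  obtains h :: "'a phq" where "phq_lie_algebra h" "nilpotent_lie h"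
    "dim (carr g) = dim (carr h) + 4" "is_double_extension_of g h"
proof -
  interpret phq_algebra g by unfold_locales (rule assms(1))
  obtain z where z: "z \<in> carr g" "z \<noteq> 0" "met g z z = 0"
    "\<And>x. x \<in> carr g \<Longrightarrow> br g z x = 0" "\<And>x. x \<in> carr g \<Longrightarrow> br g (cpx g z) x = 0"
    using exists_central_isotropic[OF assms(2,3)] by blast
  show thesis by (rule double_extension_of_central_isotropic[OF assms(2) z that])
qed

lemma nilpotent_iterated_double_extension:
  fixes g :: "'a::real_vector phq"
  assumes "phq_lie_algebra g" "nilpotent_lie g"
  shows "iterated_double_extension g"
  using assms
proof (induction "dim (carr g)" arbitrary: g rule: less_induct)
  case less
  show ?case
  proof (cases "abelian_lie g")
    case True
    then show ?thesis using less.prems(1) by (rule iterated_double_extension.base[rotated])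
  next
    case False
    obtain h :: "'a phq" where h: "phq_lie_algebra h" "nilpotent_lie h"
      "dim (carr g) = dim (carr h) + 4" "is_double_extension_of g h"
      using nonabelian_double_extension[OF less.prems False] .
    have "iterated_double_extension h" by (rule less.hyps) (use h in auto)
    then show ?thesis using h(4) by (rule iterated_double_extension.step)
  qed
qed

lemma abelian_alternative:
  fixes g :: "'a::real_vector phq"
  assumes "phq_lie_algebra g" "nilpotent_lie g" "abelian_lie g" "dim (carr g) > 0"
  shows "(\<exists>h :: 'a phq. phq_lie_algebra h \<and> dim (carr g) = dim (carr h) + 4 \<and>
        is_double_extension_of g h) \<or>
      (\<exists>(h :: 'a phq) (r :: (real \<times> real) phq).
        phq_lie_algebra h \<and> nilpotent_lie h \<and> dim (carr g) = dim (carr h) + 2 \<and>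
        phq_lie_algebra r \<and> carr r = UNIV \<and> abelian_lie r \<and> definite_metric r \<and>
        phq_equivalent g (orthogonal_sum h r))"
proof -
  interpret phq_algebra g by unfold_locales (rule assms(1))
  have "\<not> carr g \<subseteq> {0}" using assms(4) dim_le_card[of "carr g" "{}"] by auto
  then obtain e where e: "e \<in> carr g" "e \<noteq> 0" by blast
  show ?thesis
  proof (cases "met g e e = 0")
    case True
    have central: "br g e x = 0" "br g (cpx g e) x = 0" if "x \<in> carr g" for x
      using assms(3) e(1) that unfolding abelian_lie_def by simp_all
    show ?thesis
      by (rule double_extension_of_central_isotropic[OF assms(2) e True central]) blast+
  next
    case False
    then show ?thesis using abelian_orthogonal_plane[OF assms(3) e(1)] by blast
  qed
qed

theorem theorem2p4:
  fixes g :: "'a::real_vector phq"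
  assumes "phq_lie_algebra g" and "nilpotent_lie g"
  shows
    "(dim (carr g) > 4 \<longrightarrow>
       ((\<exists>h :: 'a phq. phq_lie_algebra h \<and> dim (carr h) = dim (carr g) - 4 \<and>
            is_double_extension_of g h) \<or>
        (\<exists>(h :: 'a phq) (r :: (real \<times> real) phq).
            phq_lie_algebra h \<and> nilpotent_lie h \<and> dim (carr h) = dim (carr g) - 2 \<and>
            phq_lie_algebra r \<and> carr r = UNIV \<and> abelian_lie r \<and> definite_metric r \<and>
            phq_equivalent g (orthogonal_sum h r))) \<and>
       (\<not> abelian_lie g \<longrightarrow>
         (\<exists>h :: 'a phq. phq_lie_algebra h \<and> dim (carr h) = dim (carr g) - 4 \<and>
            is_double_extension_of g h))) \<and>
     (\<not> abelian_lie g \<longrightarrow> iterated_double_extension g)"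
proof -
  have nonab: "\<exists>h :: 'a phq. phq_lie_algebra h \<and> dim (carr h) = dim (carr g) - 4 \<and>
      is_double_extension_of g h" if na: "\<not> abelian_lie g"
  proof -
    obtain h :: "'a phq" where "phq_lie_algebra h" "nilpotent_lie h"
      "dim (carr g) = dim (carr h) + 4" "is_double_extension_of g h"
      using nonabelian_double_extension[OF assms na] .
    then show ?thesis by (intro exI[of _ h]) simp
  qed
  have add_diff: "m = k + j \<Longrightarrow> k = m - j" for m k j :: nat by simp
  show ?thesis
  proof (cases "abelian_lie g")
    case True
    then show ?thesis using abelian_alternative[OF assms True] add_diff by fastforce
  next
    case False
    then show ?thesis using nonab nilpotent_iterated_double_extension[OF assms] by blast
  qed
qed

end
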